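(* Let $\mathcal{C}_3$ denote the set of integers occurring as a coordinate of some 3-color fair game, i.e. of some triple of non-negative integers $(x_1,x_2,x_3)$ with $(x_1+x_2+x_3)^2-(x_1+x_2+x_3)-4(x_1x_2+x_1x_3+x_2x_3)=0$. Then the 3-color fair games are exactly (up to permutation of coordinates) the triples $$\left(\frac{u^2+(2c+1)u+c(c-1)}{2(2c+1)},\ \frac{u^2-(2c+1)u+c(c-1)}{2(2c+1)},\ c\right)$$ where $c\in\mathcal{C}_3$ and $u$ is an integer with $u^2\equiv -c(c-1)\pmod{2c+1}$. *)

theory Defs
  imports Complex_Main "HOL-Library.Multiset" "HOL-Number_Theory.Cong"
begin

definition fair_game3 :: "int \<Rightarrow> int \<Rightarrow> int \<Rightarrow> bool" where
  "fair_game3 x1 x2 x3 \<longleftrightarrow>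
     0 \<le> x1 \<and> 0 \<le> x2 \<and> 0 \<le> x3 \<and>
     (x1 + x2 + x3)^2 - (x1 + x2 + x3) - 4 * (x1 * x2 + x1 * x3 + x2 * x3) = 0"

definition C3 :: "int set" where
  "C3 = {c. \<exists>x1 x2 x3. fair_game3 x1 x2 x3 \<and> (c = x1 \<or> c = x2 \<or> c = x3)}"

text \<open>The fractions are rational numbers (no truncating division), so that integrality
  and non-negativity of the entries are not built into the definition.\<close>

definition param_triple :: "int \<Rightarrow> int \<Rightarrow> rat list" where
  "param_triple c u =
     [of_int (u^2 + (2 * c + 1) * u + c * (c - 1)) / of_int (2 * (2 * c + 1)),
      of_int (u^2 - (2 * c + 1) * u + c * (c - 1)) / of_int (2 * (2 * c + 1)),
      of_int c]"

end

theory Submission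
  imports Defs
begin

text \<open>With \<open>s = x1 + x2\<close> and \<open>u = x1 - x2\<close>, the equation becomes linear in \<open>s\<close>:
  \<open>(2 c + 1) s = u^2 + c (c - 1)\<close> for \<open>c = x3\<close>. So \<open>c\<close> and \<open>u\<close> determine the game, and integrality of
  \<open>s\<close> is the congruence. As \<open>2 c + 1\<close> is odd, \<open>s\<close> and \<open>u\<close> have the same parity. The quadratic
  \<open>u^2 - (2 c + 1) u + c (c - 1)\<close> has discriminant \<open>8 c + 1\<close>, so each of the first two entries is
  greater than \<open>-1/2\<close>; being an integer, it is non-negative.\<close>

lemma fair_game3_equation_iff:
  fixes x1 x2 x3 :: int
  shows "(x1 + x2 + x3)^2 - (x1 + x2 + x3) - 4 * (x1 * x2 + x1 * x3 + x2 * x3) = 0 \<longleftrightarrow>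
     (2 * x3 + 1) * (x1 + x2) = (x1 - x2)^2 + x3 * (x3 - 1)"
  by (auto simp: power2_eq_square algebra_simps)

lemma param_triple_eq:
  assumes "0 \<le> c" and "(2 * c + 1) * (a + b) = (a - b)^2 + c * (c - 1)"
  shows "param_triple c (a - b) = [of_int a, of_int b, of_int c]"
proof -
  \<comment> \<open>Adding or subtracting \<open>(2 * c + 1) * (a - b)\<close> on both sides of the
    hypothesis leaves \<open>2 * a\<close> or \<open>2 * b\<close> as the cofactor of
    \<open>2 * c + 1\<close>.\<close>
  have "(a - b)^2 + (2 * c + 1) * (a - b) + c * (c - 1) = a * (2 * (2 * c + 1))"
    and "(a - b)^2 - (2 * c + 1) * (a - b) + c * (c - 1) = b * (2 * (2 * c + 1))"
    using assms(2) by (simp_all add: algebra_simps)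
  moreover have "(of_int (2 * (2 * c + 1)) :: rat) \<noteq> 0"
    unfolding of_int_eq_0_iff using assms(1) by simp
  ultimately show ?thesis
    unfolding param_triple_def by (simp only: of_int_mult nonzero_mult_div_cancel_right mult_eq_0_iff simp_thms)
qed

lemma first_entry_nonneg:
  fixes a b c :: int
  assumes "0 \<le> c" and eq: "(2 * c + 1) * (a + b) = (a - b)^2 + c * (c - 1)"
  shows "0 \<le> a"
proof (rule ccontr)
  assume "\<not> 0 \<le> a"
  \<comment> \<open>Integrality gives \<open>a + 1 \<le> 0\<close>; completing the square in
    \<open>a - b\<close> makes the same product positive.\<close>
  then have "8 * (2 * c + 1) * (a + 1) \<le> 0"
    using assms(1) by (intro mult_nonneg_nonpos) auto
  moreover have "8 * (2 * c + 1) * (a + 1) = (2 * (a - b) + (2 * c + 1))^2 + (8 * c + 7)"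
    using eq by (simp add: power2_eq_square algebra_simps)
  ultimately show False
    using assms(1) zero_le_power2[of "2 * (a - b) + (2 * c + 1)"] by linarith
qed

text \<open>Swapping \<open>a\<close> and \<open>b\<close> only changes the sign of
  \<open>a - b\<close>, so the bound for the first entry serves both.\<close>

lemma fair_game3_iff:
  "fair_game3 a b c \<longleftrightarrow> 0 \<le> c \<and> (2 * c + 1) * (a + b) = (a - b)^2 + c * (c - 1)"
proof -
  have "0 \<le> a \<and> 0 \<le> b"
    if "0 \<le> c" "(2 * c + 1) * (a + b) = (a - b)^2 + c * (c - 1)"
    using that first_entry_nonneg[of c a b] first_entry_nonneg[of c b a]
    by (simp add: add.commute power2_commute)
  then show ?thesis
    unfolding fair_game3_def fair_game3_equation_iff by blast
qed

lemma fair_game3_of_cong: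
  assumes "0 \<le> c" and "[u^2 = - (c * (c - 1))] (mod (2 * c + 1))"
  obtains a b where "fair_game3 a b c" and "u = a - b"
proof -
  obtain s where s: "u^2 + c * (c - 1) = (2 * c + 1) * s"
    using assms(2) by (auto simp: cong_iff_dvd_diff elim: dvdE)
  \<comment> \<open>Since \<open>c * (c - 1)\<close> is even, this compares the parities of
    \<open>u^2\<close> and \<open>s\<close>.\<close>
  have "even (u^2 + c * (c - 1)) = even ((2 * c + 1) * s)"
    using s by simp
  then have "even (s - u)"
    by auto
  then obtain b where "s = u + 2 * b"
    by (metis diff_add_cancel add.commute dvdE)
  with s assms(1) show ?thesis
    by (intro that[of "u + b" b]) (auto simp: fair_game3_iff algebra_simps)
qed

lemma fair_game3_permute:
  assumes "mset [x, y, z] = mset [a, b, c]" and "fair_game3 a b c"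
  shows "fair_game3 x y z"
  using assms by (auto simp: fair_game3_def add_eq_conv_ex algebra_simps)

lemma C3_nonneg: "c \<in> C3 \<Longrightarrow> 0 \<le> c"
  by (auto simp: C3_def fair_game3_def)

theorem theorem5p3:
  "{[of_int x1, of_int x2, of_int x3] | x1 x2 x3. fair_game3 x1 x2 x3} =
   {ys :: rat list. \<exists>c \<in> C3. \<exists>u :: int.
      [u^2 = - (c * (c - 1))] (mod (2 * c + 1)) \<and> mset ys = mset (param_triple c u)}"
  (is "?L = ?R")
proof (intro equalityI subsetI)
  fix ys :: "rat list"
  assume "ys \<in> ?L"
  then obtain a b c where ys: "ys = [of_int a, of_int b, of_int c]" and game: "fair_game3 a b c"
    by blast
  then have eq: "0 \<le> c" "(2 * c + 1) * (a + b) = (a - b)^2 + c * (c - 1)"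
    by (simp_all add: fair_game3_iff)
  have "[(a - b)^2 = - (c * (c - 1))] (mod (2 * c + 1))"
    unfolding cong_iff_dvd_diff using eq(2) by (metis diff_minus_eq_add dvd_triv_left)
  moreover have "c \<in> C3"
    using game by (auto simp: C3_def)
  ultimately show "ys \<in> ?R"
    using param_triple_eq[OF eq] ys by (auto intro!: bexI[of _ c] exI[of _ "a - b"])
next
  fix ys :: "rat list"
  assume "ys \<in> ?R"
  then obtain c u where "c \<in> C3" and cong: "[u^2 = - (c * (c - 1))] (mod (2 * c + 1))"
    and ys: "mset ys = mset (param_triple c u)"
    by blast
  then obtain a b where game: "fair_game3 a b c" and "u = a - b"
    using fair_game3_of_cong C3_nonneg by metis
  then have ys: "mset ys = mset (map of_int [a, b, c])"
    using ys param_triple_eq by (simp add: fair_game3_iff)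
  \<comment> \<open>The entries of \<open>ys\<close> are integers in \<open>rat\<close>;
    \<open>floor\<close> brings them back to \<open>int\<close> unchanged, where permutation
    invariance of games applies.\<close>
  define zs where "zs = map floor ys"
  have "mset zs = image_mset floor (mset ys)"
    by (simp add: zs_def)
  then have zs: "mset zs = mset [a, b, c]"
    unfolding ys by simp
  have "set ys = set (map of_int [a, b, c])"
    using ys by (rule mset_eq_setD)
  then have ys_eq: "ys = map of_int zs"
    unfolding zs_def map_map by (intro map_idI[symmetric]) auto
  from zs have "length zs = 3"
    by (metis length_Cons list.size(3) numeral_3_eq_3 size_mset)
  then obtain x y z where "zs = [x, y, z]"
    by (auto simp: numeral_3_eq_3 length_Suc_conv)
  with zs ys_eq game show "ys \<in> ?L"
    using fair_game3_permute by auto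
qed

end
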